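(* The set $\mathrm{FINL}=\{e\in\mathbb N : \mathcal L_e \text{ is TxtFin-learnable}\}$, where $\mathcal L_e$ is the uniformly computably enumerable family coded by $e$, is $\Sigma^0_3$-hard: for every $\Sigma^0_3$ predicate $P$ on $\mathbb N$ there is a computable function $h:\mathbb N\to\mathbb N$ such that for all $e$, $P(e)$ holds if and only if $h(e)\in\mathrm{FINL}$.
   Context: Fix a computable pairing function $\langle\cdot,\cdot\rangle:\mathbb N^2\to\mathbb N$ and a standard numbering $W_0,W_1,\dots$ of the computably enumerable (c.e.) sets. A number $e$ codes the uniformly computably enumerable (u.c.e.) family $\mathcal L_e=\{L_0,L_1,\dots\}$ whose $i$-th member (column) is $L_i=\{x:\langle i,x\rangle\in W_e\}$; the u.c.e. families are exactly those of this form. An enumeration is a function $f:\mathbb N\to\mathbb N$; $\mathrm{content}(f)=\{x:(\exists n)\,f(n)=x\}$; $f$ is an enumeration of (for) a set $A$ if $\mathrm{content}(f)=A$. $f\upharpoonright n$ is the initial segment of $f$ of length $n$, a finite string of natural numbers. Fix a symbol $?$ (meaning that no hypothesis has been made yet). A learning machine is a (possibly partial) computable function $M$ from finite strings of natural numbers to $\mathbb N\cup\{?\}$; a statement about a value of $M$ includes that this value is defined. $M$ TxtFin-identifies an enumeration $f$ if there is $n$ such that $M(f\upharpoonright n')=\,?$ for all $n'<n$, $M(f\upharpoonright n)\neq\,?$, and $W_{M(f\upharpoonright n)}=\mathrm{content}(f)$. $M$ TxtFin-learns a c.e. set $A$ if it TxtFin-identifies every enumeration of $A$. $M$ TxtFin-learns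 a family of c.e. sets if it TxtFin-learns every member of the family. A family is TxtFin-learnable if some learning machine TxtFin-learns it. *)

theory Defs
  imports Main "HOL-Library.Nat_Bijection"
begin

section \<open>Computability\<close>

text \<open>
  Kleene's partial recursive functions. An n-ary partial function is modelled by a function on
  lists with \<^const>\<open>None\<close> for ``undefined''; only its values on lists of length n are meaningful,
  which is what rule \<open>ext\<close> expresses.
\<close>

inductive partrec :: "nat \<Rightarrow> (nat list \<Rightarrow> nat option) \<Rightarrow> bool" where
  zero: "partrec n (\<lambda>xs. Some 0)"
| succ: "partrec 1 (\<lambda>xs. Some (Suc (xs ! 0)))"
| proj: "i < n \<Longrightarrow> partrec n (\<lambda>xs. Some (xs ! i))"
| comp: "partrec (length hs) g \<Longrightarrow> (\<forall>h\<in>set hs. partrec n h) \<Longrightarrow>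
    partrec n (\<lambda>xs. Option.bind (those (map (\<lambda>h. h xs) hs)) g)"
| prec: "partrec n g \<Longrightarrow> partrec (Suc (Suc n)) h \<Longrightarrow>
    partrec (Suc n) (\<lambda>xs. rec_nat (g (tl xs))
      (\<lambda>k r. Option.bind r (\<lambda>v. h (k # v # tl xs))) (hd xs))"
| mu: "partrec (Suc n) g \<Longrightarrow>
    partrec n (\<lambda>xs. if \<exists>z. g (z # xs) = Some 0 \<and> (\<forall>y<z. g (y # xs) \<noteq> None)
      then Some (LEAST z. g (z # xs) = Some 0) else None)"
| ext: "partrec n f \<Longrightarrow> (\<forall>xs. length xs = n \<longrightarrow> f xs = g xs) \<Longrightarrow> partrec n g"

definition computable :: "(nat \<Rightarrow> nat) \<Rightarrow> bool" where
  "computable f \<longleftrightarrow> partrec 1 (\<lambda>xs. Some (f (xs ! 0)))"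

definition computable2 :: "(nat \<Rightarrow> nat \<Rightarrow> nat) \<Rightarrow> bool" where
  "computable2 f \<longleftrightarrow> partrec 2 (\<lambda>xs. Some (f (xs ! 0) (xs ! 1)))"

definition decidable4 :: "(nat \<Rightarrow> nat \<Rightarrow> nat \<Rightarrow> nat \<Rightarrow> bool) \<Rightarrow> bool" where
  "decidable4 R \<longleftrightarrow>
    partrec 4 (\<lambda>xs. Some (if R (xs ! 0) (xs ! 1) (xs ! 2) (xs ! 3) then 1 else 0))"

definition ce_set :: "nat set \<Rightarrow> bool" where
  "ce_set A \<longleftrightarrow> (\<exists>\<psi>. partrec 1 \<psi> \<and> (\<forall>x. x \<in> A \<longleftrightarrow> \<psi> [x] \<noteq> None))"

definition ce_rel :: "(nat \<Rightarrow> nat \<Rightarrow> bool) \<Rightarrow> bool" where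
  "ce_rel R \<longleftrightarrow> (\<exists>\<psi>. partrec 2 \<psi> \<and> (\<forall>i x. R i x \<longleftrightarrow> \<psi> [i, x] \<noteq> None))"

definition Sigma3 :: "(nat \<Rightarrow> bool) \<Rightarrow> bool" where
  "Sigma3 P \<longleftrightarrow> (\<exists>R. decidable4 R \<and> (\<forall>e. P e \<longleftrightarrow> (\<exists>a. \<forall>b. \<exists>c. R e a b c)))"

definition Sigma3_hard :: "nat set \<Rightarrow> bool" where
  "Sigma3_hard A \<longleftrightarrow> (\<forall>P. Sigma3 P \<longrightarrow> (\<exists>h. computable h \<and> (\<forall>e. P e \<longleftrightarrow> h e \<in> A)))"

definition pairing_function :: "(nat \<Rightarrow> nat \<Rightarrow> nat) \<Rightarrow> bool" where
  "pairing_function p \<longleftrightarrow> computable2 p \<and> bij (\<lambda>(i, x). p i x)"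

text \<open>
  A standard numbering of the c.e. sets is an acceptable one in the sense of Rogers: it is
  uniformly c.e. (enumeration theorem), and every uniformly c.e. sequence of sets reduces to it by
  a computable function (s-m-n theorem). The usual numbering by domains of the partial recursive
  functions has these two properties.
\<close>

definition standard_numbering :: "(nat \<Rightarrow> nat set) \<Rightarrow> bool" where
  "standard_numbering W \<longleftrightarrow>
    ce_rel (\<lambda>e x. x \<in> W e) \<and>
    (\<forall>R. ce_rel R \<longrightarrow> (\<exists>s. computable s \<and> (\<forall>i. W (s i) = {x. R i x})))"

lemma ce_rel_section:
  assumes "ce_rel R"
  shows "ce_set {x. R i x}"
proof -
  obtain \<psi> where \<psi>: "partrec 2 \<psi>" "\<forall>i x. R i x \<longleftrightarrow> \<psi> [i, x] \<noteq> None"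
    using assms by (auto simp: ce_rel_def)
  have const: "partrec 1 (\<lambda>xs. Some i)" for i
  proof (induction i)
    case 0
    show ?case by (rule partrec.zero)
  next
    case (Suc i)
    have "partrec 1 (\<lambda>xs. Option.bind (those (map (\<lambda>h. h xs) [\<lambda>xs. Some i]))
        (\<lambda>xs. Some (Suc (xs ! 0))))"
      by (rule partrec.comp) (use Suc partrec.succ in auto)
    then show ?case by simp
  qed
  have "partrec 1 (\<lambda>xs. Option.bind (those (map (\<lambda>h. h xs)
      [\<lambda>xs. Some i, \<lambda>xs. Some (xs ! 0)])) \<psi>)"
    by (rule partrec.comp) (use \<psi>(1) const partrec.proj[of 0 1] in \<open>auto simp: numeral_2_eq_2\<close>)
  then show ?thesis
    unfolding ce_set_def using \<psi>(2) by (intro exI conjI) auto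
qed

lemma range_standard_numbering:
  assumes "standard_numbering W"
  shows "range W = {A. ce_set A}"
proof (intro equalityI subsetI)
  fix A assume "A \<in> range W"
  then obtain e where "A = {x. x \<in> W e}" by auto
  then show "A \<in> {A. ce_set A}"
    using assms ce_rel_section[of "\<lambda>e x. x \<in> W e" e] by (auto simp: standard_numbering_def)
next
  fix A assume "A \<in> {A. ce_set A}"
  then obtain \<psi> where \<psi>: "partrec 1 \<psi>" "\<forall>x. x \<in> A \<longleftrightarrow> \<psi> [x] \<noteq> None"
    by (auto simp: ce_set_def)
  have "partrec 2 (\<lambda>xs. Option.bind (those (map (\<lambda>h. h xs) [\<lambda>xs. Some (xs ! 1)])) \<psi>)"
    by (rule partrec.comp) (use \<psi>(1) partrec.proj[of 1 2] in auto)
  then have "ce_rel (\<lambda>i x. x \<in> A)"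
    unfolding ce_rel_def using \<psi>(2) by (intro exI conjI) auto
  then obtain s where "\<forall>i. W (s i) = {x. x \<in> A}"
    using assms unfolding standard_numbering_def by blast
  then show "A \<in> range W" by auto
qed


section \<open>Finite learning from text\<close>

definition column :: "(nat \<Rightarrow> nat set) \<Rightarrow> (nat \<Rightarrow> nat \<Rightarrow> nat) \<Rightarrow> nat \<Rightarrow> nat \<Rightarrow> nat set" where
  "column W p e i = {x. p i x \<in> W e}"

definition uce_family :: "(nat \<Rightarrow> nat set) \<Rightarrow> (nat \<Rightarrow> nat \<Rightarrow> nat) \<Rightarrow> nat \<Rightarrow> nat set set" where
  "uce_family W p e = range (column W p e)"

text \<open>\<open>NoHyp\<close> is the symbol ``?''.\<close>

datatype hypothesis = NoHyp | Hyp nat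

fun hyp_encode :: "hypothesis \<Rightarrow> nat" where
  "hyp_encode NoHyp = 0"
| "hyp_encode (Hyp c) = Suc c"

text \<open>
  \<open>M \<sigma> = None\<close> means that the machine is undefined on the string \<open>\<sigma>\<close>. Strings and outputs are
  coded by numbers in order to speak of computability.
\<close>

definition learning_machine :: "(nat list \<Rightarrow> hypothesis option) \<Rightarrow> bool" where
  "learning_machine M \<longleftrightarrow> partrec 1 (\<lambda>xs. map_option hyp_encode (M (list_decode (xs ! 0))))"

definition init_seg :: "(nat \<Rightarrow> nat) \<Rightarrow> nat \<Rightarrow> nat list" where
  "init_seg f n = map f [0..<n]"

definition content :: "(nat \<Rightarrow> nat) \<Rightarrow> nat set" where
  "content f = {x. \<exists>n. f n = x}"

definition txtfin_identifies ::
    "(nat \<Rightarrow> nat set) \<Rightarrow> (nat list \<Rightarrow> hypothesis option) \<Rightarrow> (nat \<Rightarrow> nat) \<Rightarrow> bool" where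
  "txtfin_identifies W M f \<longleftrightarrow>
    (\<exists>n c. (\<forall>n'<n. M (init_seg f n') = Some NoHyp) \<and>
      M (init_seg f n) = Some (Hyp c) \<and> W c = content f)"

definition txtfin_learns ::
    "(nat \<Rightarrow> nat set) \<Rightarrow> (nat list \<Rightarrow> hypothesis option) \<Rightarrow> nat set \<Rightarrow> bool" where
  "txtfin_learns W M A \<longleftrightarrow> (\<forall>f. content f = A \<longrightarrow> txtfin_identifies W M f)"

definition txtfin_learnable :: "(nat \<Rightarrow> nat set) \<Rightarrow> nat set set \<Rightarrow> bool" where
  "txtfin_learnable W F \<longleftrightarrow> (\<exists>M. learning_machine M \<and> (\<forall>A\<in>F. txtfin_learns W M A))"

definition FINL :: "(nat \<Rightarrow> nat set) \<Rightarrow> (nat \<Rightarrow> nat \<Rightarrow> nat) \<Rightarrow> nat set" where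
  "FINL W p = {e. txtfin_learnable W (uce_family W p e)}"

end

theory Submission
  imports Defs
begin

text \<open>
  Write P e as \<open>\<exists>a. \<forall>b. \<exists>c. R e a b c\<close>. The family consists of blocks, the m-th of which defeats the
  m-th machine unless a witness \<open>a \<le> m\<close> for P e exists. All sets in block m contain a marker; once the
  m-th machine makes a guess on the text that repeats this marker, the b-th set of the block gets a
  private element tagged b. Each time that some \<open>a \<le> m\<close> looks better as a witness, the
  current private elements are put into all sets of the block and new ones are appended. If P e
  fails, this stops, so the sets of a block on which the machine makes a guess are different, while
  the machine already guesses on their common marker; a machine without such a guess misses the
  set that consists of the marker alone. If a witnesses P e, then all sets in a block
  \<open>m \<ge> a\<close> are equal, so the marker suffices to guess them. For each of the finitely many remaining
  blocks one number is enough to know which elements are private forever, and such an element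
  reveals its set. This learner depends only on the last element of the string.
\<close>

section \<open>Total recursive functions\<close>

definition trec :: "nat \<Rightarrow> (nat list \<Rightarrow> nat) \<Rightarrow> bool" where
  "trec n f \<longleftrightarrow> partrec n (\<lambda>xs. Some (f xs))"

definition tdec :: "nat \<Rightarrow> (nat list \<Rightarrow> bool) \<Rightarrow> bool" where
  "tdec n Q \<longleftrightarrow> trec n (\<lambda>xs. if Q xs then 1 else 0)"

lemma those_map_Some: "those (map (\<lambda>x. Some (f x)) xs) = Some (map f xs)"
  by (induction xs) auto

lemma trec_cong:
  assumes "trec n f" "\<And>xs. length xs = n \<Longrightarrow> f xs = g xs"
  shows "trec n g"
  using partrec.ext[of n "\<lambda>xs. Some (f xs)" "\<lambda>xs. Some (g xs)"] assms by (simp add: trec_def)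

lemma tdec_cong:
  assumes "tdec n P" "\<And>xs. length xs = n \<Longrightarrow> P xs = Q xs"
  shows "tdec n Q"
  using assms(1) unfolding tdec_def by (rule trec_cong) (simp add: assms(2))

lemma partrec_subst:
  assumes "partrec (length fs) \<phi>" "\<And>f. f \<in> set fs \<Longrightarrow> trec n f"
  shows "partrec n (\<lambda>xs. \<phi> (map (\<lambda>f. f xs) fs))"
proof -
  have "partrec n (\<lambda>xs. Option.bind (those (map (\<lambda>h. h xs) (map (\<lambda>f xs. Some (f xs)) fs))) \<phi>)"
    by (rule partrec.comp) (use assms in \<open>auto simp: trec_def\<close>)
  then show ?thesis by (simp add: comp_def those_map_Some)
qed

lemma trec_subst:
  assumes "trec (length fs) g" "\<And>f. f \<in> set fs \<Longrightarrow> trec n f"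
  shows "trec n (\<lambda>xs. g (map (\<lambda>f. f xs) fs))"
  using partrec_subst[OF assms[unfolded trec_def[of "length fs"]]] by (simp add: trec_def)

lemma trec_nth: "i < n \<Longrightarrow> trec n (\<lambda>xs. xs ! i)"
  unfolding trec_def by (rule partrec.proj)

lemma trec_hd: "0 < n \<Longrightarrow> trec n hd"
  by (rule trec_cong[OF trec_nth[of 0]]) (auto simp: hd_conv_nth)

lemma trec_tl:
  assumes "trec n f"
  shows "trec (Suc n) (\<lambda>xs. f (tl xs))"
proof -
  have "trec (Suc n) (\<lambda>xs. f (map (\<lambda>g. g xs) (map (\<lambda>i xs. xs ! Suc i) [0..<n])))"
    by (rule trec_subst) (use assms trec_nth in auto)
  then show ?thesis
    by (rule trec_cong) (auto intro!: arg_cong[where f=f] nth_equalityI simp: nth_tl)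
qed

text \<open>Closure rules that bind a variable put it at \<open>hd\<close> and move the others into
  \<open>tl\<close>; these forms let projections be recognised under nested binders.\<close>

lemma trec_tl_nth: "Suc i < n \<Longrightarrow> trec n (\<lambda>xs. tl xs ! i)"
  by (rule trec_cong[OF trec_nth[of "Suc i"]]) (auto simp: nth_tl)

lemma trec_tl_tl_nth: "Suc (Suc i) < n \<Longrightarrow> trec n (\<lambda>xs. tl (tl xs) ! i)"
  by (rule trec_cong[OF trec_nth[of "Suc (Suc i)"]]) (auto simp: nth_tl)

lemma trec_tl_tl_tl_nth: "Suc (Suc (Suc i)) < n \<Longrightarrow> trec n (\<lambda>xs. tl (tl (tl xs)) ! i)"
  by (rule trec_cong[OF trec_nth[of "Suc (Suc (Suc i))"]]) (auto simp: nth_tl)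

lemma trec_tl_tl_tl_tl_nth:
  "Suc (Suc (Suc (Suc i))) < n \<Longrightarrow> trec n (\<lambda>xs. tl (tl (tl (tl xs))) ! i)"
  by (rule trec_cong[OF trec_nth[of "Suc (Suc (Suc (Suc i)))"]]) (auto simp: nth_tl)

lemma hd_eq_nth: "0 < length xs \<Longrightarrow> hd xs = xs ! 0"
  by (cases xs) auto

lemma trec_tl_hd: "Suc 0 < n \<Longrightarrow> trec n (\<lambda>xs. hd (tl xs))"
  by (rule trec_cong[OF trec_nth[of "Suc 0"]]) (auto simp: nth_tl hd_eq_nth)

lemma trec_tl_tl_hd: "Suc (Suc 0) < n \<Longrightarrow> trec n (\<lambda>xs. hd (tl (tl xs)))"
  by (rule trec_cong[OF trec_nth[of "Suc (Suc 0)"]]) (auto simp: nth_tl hd_eq_nth)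

lemma trec_comp1:
  assumes "computable g" "trec n f"
  shows "trec n (\<lambda>xs. g (f xs))"
  using trec_subst[of "[f]" "\<lambda>xs. g (xs ! 0)" n] assms by (simp add: trec_def computable_def)

lemma trec_comp2:
  assumes "computable2 g" "trec n f1" "trec n f2"
  shows "trec n (\<lambda>xs. g (f1 xs) (f2 xs))"
  using trec_subst[of "[f1, f2]" "\<lambda>xs. g (xs ! 0) (xs ! 1)" n] assms
  by (auto simp: trec_def computable2_def numeral_2_eq_2)

lemma tdec_comp4:
  assumes "decidable4 R" "trec n f1" "trec n f2" "trec n f3" "trec n f4"
  shows "tdec n (\<lambda>xs. R (f1 xs) (f2 xs) (f3 xs) (f4 xs))"
  unfolding tdec_def
  using trec_subst[of "[f1, f2, f3, f4]"
      "\<lambda>xs. if R (xs ! 0) (xs ! 1) (xs ! 2) (xs ! 3) then 1 else 0" n] assms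
  by (auto simp: trec_def decidable4_def eval_nat_numeral)

lemma trec_Suc: "trec n f \<Longrightarrow> trec n (\<lambda>xs. Suc (f xs))"
  by (rule trec_comp1[of Suc]) (use partrec.succ in \<open>simp_all add: computable_def\<close>)

lemma trec_const: "trec n (\<lambda>xs. c)"
  by (induction c) (auto simp: trec_def partrec.zero dest: trec_Suc[unfolded trec_def])

lemma trec_rec:
  assumes g: "trec n g" and h: "trec (Suc (Suc n)) (\<lambda>ys. h (hd ys) (hd (tl ys)) (tl (tl ys)))"
    and k: "trec n k"
  shows "trec n (\<lambda>xs. rec_nat (g xs) (\<lambda>i r. h i r xs) (k xs))"
proof -
  have "partrec (Suc n) (\<lambda>xs. rec_nat (Some (g (tl xs)))
      (\<lambda>k r. Option.bind r (\<lambda>v. Some (h k v (tl xs)))) (hd xs))"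
    using partrec.prec[OF g[unfolded trec_def] h[unfolded trec_def]] by simp
  moreover have "rec_nat (Some a) (\<lambda>k r. Option.bind r (\<lambda>v. Some (w k v))) j
      = Some (rec_nat a w j)" for a :: nat and w j
    by (induction j) auto
  ultimately have "trec (Suc n) (\<lambda>xs. rec_nat (g (tl xs)) (\<lambda>i r. h i r (tl xs)) (hd xs))"
    by (simp add: trec_def)
  then have "trec n (\<lambda>xs. (\<lambda>xs. rec_nat (g (tl xs)) (\<lambda>i r. h i r (tl xs)) (hd xs))
      (map (\<lambda>f. f xs) (k # map (\<lambda>i xs. xs ! i) [0..<n])))"
    by (intro trec_subst) (use k trec_nth in auto)
  moreover have "map (\<lambda>i. xs ! i) [0..<n] = xs" if "length xs = n" for xs :: "nat list"
    using map_nth[of xs] that by simp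
  ultimately show ?thesis
    by (elim trec_cong) (auto simp: comp_def)
qed

lemmas trec_vars = trec_nth trec_hd trec_tl_nth trec_tl_tl_nth trec_tl_tl_tl_nth
  trec_tl_tl_tl_tl_nth trec_tl_hd trec_tl_tl_hd

section \<open>Branching, arithmetic, comparison, bounded quantifiers and search\<close>

text \<open>The truth value of \<open>Q\<close> is the number of recursion steps: none leaves
  \<open>g\<close>, one replaces it by \<open>f\<close>.\<close>

lemma trec_If:
  assumes "tdec n Q" "trec n f" "trec n g"
  shows "trec n (\<lambda>xs. if Q xs then f xs else g xs)"
proof -
  have "trec n (\<lambda>xs. rec_nat (g xs) (\<lambda>i r. f xs) (if Q xs then 1 else 0))"
    by (rule trec_rec) (use assms in \<open>auto intro: trec_tl simp: tdec_def\<close>)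
  then show ?thesis by (rule trec_cong) auto
qed

lemma trec_add:
  assumes "trec n f" "trec n g"
  shows "trec n (\<lambda>xs. f xs + g xs)"
proof -
  have "trec n (\<lambda>xs. rec_nat (f xs) (\<lambda>i r. Suc r) (g xs))"
    by (rule trec_rec) (use assms in \<open>auto intro!: trec_Suc trec_vars\<close>)
  moreover have "rec_nat a (\<lambda>i r. Suc r) b = a + b" for a b :: nat by (induction b) auto
  ultimately show ?thesis by simp
qed

lemma trec_pred:
  assumes "trec n f"
  shows "trec n (\<lambda>xs. f xs - 1)"
proof -
  have "trec n (\<lambda>xs. rec_nat 0 (\<lambda>i r. i) (f xs))"
    by (rule trec_rec) (use assms in \<open>auto intro!: trec_const trec_vars\<close>)
  moreover have "rec_nat 0 (\<lambda>i r. i) b = b - 1" for b :: nat by (induction b) auto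
  ultimately show ?thesis by simp
qed

lemma trec_diff:
  assumes "trec n f" "trec n g"
  shows "trec n (\<lambda>xs. f xs - g xs)"
proof -
  have "trec n (\<lambda>xs. rec_nat (f xs) (\<lambda>i r. r - 1) (g xs))"
    by (intro trec_rec trec_pred trec_vars assms) auto
  moreover have "rec_nat a (\<lambda>i r. r - 1) b = a - b" for a b :: nat by (induction b) auto
  ultimately show ?thesis by simp
qed

lemma tdec_eq_0:
  assumes "trec n f"
  shows "tdec n (\<lambda>xs. f xs = 0)"
proof -
  have "trec n (\<lambda>xs. 1 - f xs)"
    by (intro trec_diff trec_const assms)
  then show ?thesis unfolding tdec_def by (rule trec_cong) auto
qed

lemma tdec_Not:
  assumes "tdec n Q"
  shows "tdec n (\<lambda>xs. \<not> Q xs)"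
  by (rule tdec_cong[OF tdec_eq_0[OF assms[unfolded tdec_def]]]) auto

lemma tdec_conj:
  assumes "tdec n P" "tdec n Q"
  shows "tdec n (\<lambda>xs. P xs \<and> Q xs)"
  unfolding tdec_def
  by (rule trec_cong[OF trec_If[OF assms(1) assms(2)[unfolded tdec_def] trec_const[of n 0]]]) auto

lemma tdec_disj:
  assumes "tdec n P" "tdec n Q"
  shows "tdec n (\<lambda>xs. P xs \<or> Q xs)"
  using tdec_Not[OF tdec_conj[OF tdec_Not[OF assms(1)] tdec_Not[OF assms(2)]]] by simp

lemma tdec_le:
  assumes "trec n f" "trec n g"
  shows "tdec n (\<lambda>xs. f xs \<le> g xs)"
  by (rule tdec_cong[OF tdec_eq_0[OF trec_diff[OF assms]]]) auto

lemma tdec_eq: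
  assumes "trec n f" "trec n g"
  shows "tdec n (\<lambda>xs. f xs = g xs)"
  by (rule tdec_cong[OF tdec_conj[OF tdec_le[OF assms] tdec_le[OF assms(2,1)]]]) auto

lemma tdec_all_less:
  assumes "tdec (Suc n) (\<lambda>ys. Q (hd ys) (tl ys))" "trec n k"
  shows "tdec n (\<lambda>xs. \<forall>i<k xs. Q i xs)"
proof -
  let ?h = "\<lambda>xs i r. if Q i xs then r else (0::nat)"
  \<comment> \<open>\<open>Q\<close> must not see the accumulator \<open>hd (tl ys)\<close>, so a
    substitution skips it.\<close>
  have "trec (Suc (Suc n)) (\<lambda>ys. (\<lambda>zs. if Q (hd zs) (tl zs) then 1 else 0)
      (map (\<lambda>f. f ys) (hd # map (\<lambda>i ys. tl (tl ys) ! i) [0..<n])))"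
    by (intro trec_subst) (use assms(1) in \<open>auto simp: tdec_def intro!: trec_vars\<close>)
  moreover have "map (\<lambda>i. tl (tl ys) ! i) [0..<n] = tl (tl ys)"
    if "length ys = Suc (Suc n)" for ys :: "nat list"
    using map_nth[of "tl (tl ys)"] that by simp
  ultimately have "tdec (Suc (Suc n)) (\<lambda>ys. Q (hd ys) (tl (tl ys)))"
    unfolding tdec_def by (elim trec_cong) (simp add: comp_def)
  then have "trec n (\<lambda>xs. rec_nat 1 (?h xs) (k xs))"
    by (intro trec_rec trec_If trec_const assms trec_vars) auto
  moreover have "rec_nat 1 (?h xs) j = (if \<forall>i<j. Q i xs then 1 else 0)" for xs j
    by (induction j) (auto simp: less_Suc_eq)
  ultimately show ?thesis unfolding tdec_def by simp
qed

lemma tdec_ex_less: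
  assumes "tdec (Suc n) (\<lambda>ys. Q (hd ys) (tl ys))" "trec n k"
  shows "tdec n (\<lambda>xs. \<exists>i<k xs. Q i xs)"
  using tdec_Not[OF tdec_all_less[OF tdec_Not[OF assms(1)] assms(2)]] by simp

text \<open>For a decidable matrix the definedness clause of \<open>mu\<close> is vacuous, and a
  solution for every argument makes the search total.\<close>

lemma trec_Least:
  assumes "tdec (Suc n) (\<lambda>ys. Q (hd ys) (tl ys))" "\<And>xs. length xs = n \<Longrightarrow> \<exists>z. Q z xs"
  shows "trec n (\<lambda>xs. LEAST z. Q z xs)"
proof -
  have "partrec n (\<lambda>xs. if \<exists>z. Some (if \<not> Q z xs then 1 else 0) = Some (0::nat) \<and>
        (\<forall>y<z. Some (if \<not> Q y xs then 1 else 0) \<noteq> (None :: nat option))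
      then Some (LEAST z. Some (if \<not> Q z xs then 1 else 0) = Some (0::nat)) else None)"
    using partrec.mu[OF tdec_Not[OF assms(1), unfolded tdec_def trec_def]]
    by (simp only: list.sel)
  then show ?thesis
    unfolding trec_def by (rule partrec.ext) (use assms(2) in auto)
qed

section \<open>Codes of pairs and lists, functions of finite support\<close>

lemma trec_prod_encode:
  assumes "trec n f" "trec n g"
  shows "trec n (\<lambda>xs. prod_encode (f xs, g xs))"
proof -
  have "trec n (\<lambda>xs. rec_nat 0 (\<lambda>i r. r + Suc i) (f xs + g xs))"
    by (rule trec_rec) (use assms in \<open>auto intro!: trec_const trec_add trec_Suc trec_vars\<close>)
  moreover have "rec_nat 0 (\<lambda>i r. r + Suc i) k = triangle k" for k
    by (induction k) auto
  ultimately have "trec n (\<lambda>xs. triangle (f xs + g xs))" by simp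
  then have "trec n (\<lambda>xs. triangle (f xs + g xs) + f xs)"
    using assms by (intro trec_add)
  then show ?thesis by (simp add: prod_encode_def)
qed

text \<open>Decoding by search: the second component is bounded by the code, so the condition
  searched for is decidable.\<close>

lemma trec_fst_prod_decode:
  assumes "trec n f"
  shows "trec n (\<lambda>xs. fst (prod_decode (f xs)))"
proof -
  have ex: "\<exists>b<Suc z. prod_encode (fst (prod_decode z), b) = z" for z
    by (rule exI[of _ "snd (prod_decode z)"])
      (metis le_prod_encode_2 less_Suc_eq_le prod.collapse prod_decode_inverse)
  then have ex2: "\<exists>a. \<exists>b<Suc z. prod_encode (a, b) = z" for z
    by blast
  have "trec n (\<lambda>xs. LEAST a. \<exists>b<Suc (f xs). prod_encode (a, b) = f xs)"
    by (intro trec_Least tdec_ex_less tdec_eq trec_prod_encode trec_Suc trec_vars trec_tl assms)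
      (use trec_tl[OF trec_tl[OF assms]] in \<open>auto intro: ex2\<close>)
  moreover have "(LEAST a. \<exists>b<Suc z. prod_encode (a, b) = z) = fst (prod_decode z)" for z
    using ex by (intro Least_equality) auto
  ultimately show ?thesis by simp
qed

lemma trec_snd_prod_decode:
  assumes "trec n f"
  shows "trec n (\<lambda>xs. snd (prod_decode (f xs)))"
proof -
  have ex: "\<exists>a<Suc z. prod_encode (a, snd (prod_decode z)) = z" for z
    by (rule exI[of _ "fst (prod_decode z)"])
      (metis le_prod_encode_1 less_Suc_eq_le prod.collapse prod_decode_inverse)
  then have ex2: "\<exists>b. \<exists>a<Suc z. prod_encode (a, b) = z" for z
    by blast
  have "trec n (\<lambda>xs. LEAST b. \<exists>a<Suc (f xs). prod_encode (a, b) = f xs)"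
    by (intro trec_Least tdec_ex_less tdec_eq trec_prod_encode trec_Suc trec_vars trec_tl assms)
      (use trec_tl[OF trec_tl[OF assms]] in \<open>auto intro: ex2\<close>)
  moreover have "(LEAST b. \<exists>a<Suc z. prod_encode (a, b) = z) = snd (prod_decode z)" for z
    using ex by (intro Least_equality) auto
  ultimately show ?thesis by simp
qed

text \<open>The finitely many nonzero values are hard-coded by nested case distinctions, so even a
  function defined noneffectively, such as the learner's \<open>T\<close>, is recursive.\<close>

lemma trec_finite_support:
  assumes "\<And>i. i \<ge> k \<Longrightarrow> f i = 0" "trec n g"
  shows "trec n (\<lambda>xs. f (g xs))"
  using assms(1)
proof (induction k arbitrary: f)
  case 0
  then show ?case by (simp add: trec_const)
next
  case (Suc k)
  have "trec n (\<lambda>xs. if g xs = k then f k else (f(k := 0)) (g xs))"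
    by (intro trec_If tdec_eq trec_const assms(2) Suc.IH) (use Suc.prems in auto)
  then show ?case by (rule trec_cong) auto
qed

lemmas trec_intros = trec_const trec_Suc trec_add trec_pred trec_diff trec_prod_encode
  trec_fst_prod_decode trec_snd_prod_decode trec_If tdec_conj tdec_disj tdec_Not tdec_le tdec_eq
  trec_vars

lemma length_le_list_encode: "length l \<le> list_encode l"
proof (induction l)
  case (Cons x l)
  then show ?case using le_prod_encode_2[of "list_encode l" x] by simp
qed simp

lemma trec_last:
  assumes "trec n f"
  shows "trec n (\<lambda>xs. last (list_decode (f xs)))"
proof -
  \<comment> \<open>\<open>step\<close> drops the head of a coded list but fixes one-element lists,
    so iterating it isolates the last element.\<close>
  define step where "step r = (if snd (prod_decode (r - 1)) = 0 then r
    else snd (prod_decode (r - 1)))" for r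
  have step: "step (list_encode (x # l)) = list_encode (if l = [] then [x] else l)" for x l
    by (cases l) (auto simp: step_def)
  have iter: "(step ^^ k) (list_encode l) = list_encode [last l]" if "l \<noteq> []" "length l \<le> Suc k"
    for k l
    using that
  proof (induction k arbitrary: l)
    case 0
    then show ?case by (cases l) auto
  next
    case (Suc k)
    obtain x l' where l: "l = x # l'" using Suc.prems by (cases l) auto
    have "(step ^^ Suc k) (list_encode l) = (step ^^ k) (step (list_encode l))"
      by (simp only: funpow_Suc_right comp_def)
    also have "\<dots> = (step ^^ k) (list_encode (if l' = [] then [x] else l'))"
      unfolding l step ..
    also have "\<dots> = list_encode [last l]"
      using Suc.IH[of "if l' = [] then [x] else l'"] Suc.prems by (simp add: l)
    finally show ?case .
  qed
  \<comment> \<open>The code bounds the length of the list, so \<open>z\<close> iterations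
    suffice.\<close>
  have iter': "fst (prod_decode ((step ^^ z) z - 1)) = last (list_decode z)" if "z \<noteq> 0" for z
  proof -
    have "list_decode z \<noteq> []"
      using that by (metis list_decode_inverse list_encode.simps(1))
    moreover have "length (list_decode z) \<le> Suc z"
      using length_le_list_encode[of "list_decode z"] by simp
    ultimately have "(step ^^ z) z = list_encode [last (list_decode z)]"
      using iter[of "list_decode z" z] by simp
    then show ?thesis by simp
  qed
  have "trec n (\<lambda>xs. rec_nat (f xs) (\<lambda>i r. step r) (f xs))"
    unfolding step_def by (intro trec_rec trec_intros assms) auto
  moreover have "rec_nat z (\<lambda>i r. step r) k = (step ^^ k) z" for z k
    by (induction k) auto
  ultimately have "trec n (\<lambda>xs. (step ^^ f xs) (f xs))" by simp
  then have "trec n (\<lambda>xs. if f xs = 0 then last [] else fst (prod_decode ((step ^^ f xs) (f xs) - 1)))"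
    by (intro trec_intros assms)
  then show ?thesis by (rule trec_cong) (auto simp: iter'[simplified])
qed

lemma trec_replicate:
  assumes "trec n k" "trec n f"
  shows "trec n (\<lambda>xs. list_encode (replicate (k xs) (f xs)))"
proof -
  have "trec (Suc (Suc n)) (\<lambda>ys. f (tl (tl ys)))"
    by (rule trec_tl[OF trec_tl[OF assms(2)]])
  then have "trec n (\<lambda>xs. rec_nat 0 (\<lambda>i r. Suc (prod_encode (f xs, r))) (k xs))"
    by (intro trec_rec trec_intros assms) auto
  moreover have "rec_nat 0 (\<lambda>i r. Suc (prod_encode (x, r))) j = list_encode (replicate j x)" for x j
    by (induction j) auto
  ultimately show ?thesis by simp
qed

section \<open>Semidecidable predicates\<close>

definition semidec :: "nat \<Rightarrow> (nat list \<Rightarrow> bool) \<Rightarrow> bool" where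
  "semidec n Q \<longleftrightarrow> (\<exists>\<psi>. partrec n \<psi> \<and> (\<forall>xs. length xs = n \<longrightarrow> (Q xs \<longleftrightarrow> \<psi> xs \<noteq> None)))"

lemma semidec_subst:
  assumes "semidec (length fs) Q" "\<And>f. f \<in> set fs \<Longrightarrow> trec n f"
  shows "semidec n (\<lambda>xs. Q (map (\<lambda>f. f xs) fs))"
proof -
  obtain \<psi> where "partrec (length fs) \<psi>"
    "\<forall>xs. length xs = length fs \<longrightarrow> (Q xs \<longleftrightarrow> \<psi> xs \<noteq> None)"
    using assms(1) by (auto simp: semidec_def)
  then show ?thesis
    unfolding semidec_def using partrec_subst[of fs \<psi> n] assms(2)
    by (intro exI[of _ "\<lambda>xs. \<psi> (map (\<lambda>f. f xs) fs)"]) auto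
qed

text \<open>Composition is strict: a constant function applied to the values of
  \<open>\<phi>\<close> and \<open>\<psi>\<close> is defined exactly where both are.\<close>

lemma semidec_conj:
  assumes "semidec n P" "semidec n Q"
  shows "semidec n (\<lambda>xs. P xs \<and> Q xs)"
proof -
  obtain \<phi> \<psi> where *: "partrec n \<phi>" "\<forall>xs. length xs = n \<longrightarrow> (P xs \<longleftrightarrow> \<phi> xs \<noteq> None)"
    "partrec n \<psi>" "\<forall>xs. length xs = n \<longrightarrow> (Q xs \<longleftrightarrow> \<psi> xs \<noteq> None)"
    using assms by (auto simp: semidec_def)
  have conj: "partrec n (\<lambda>xs. Option.bind (those (map (\<lambda>h. h xs) [\<phi>, \<psi>])) (\<lambda>xs. Some 0))"
    by (rule partrec.comp) (use * partrec.zero in auto)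
  show ?thesis
    unfolding semidec_def
    by (rule exI, rule conjI, rule conj) (use * in \<open>auto split: option.splits\<close>)
qed

text \<open>With a decidable matrix no test diverges, so \<open>mu\<close> halts exactly when a
  solution exists.\<close>

lemma semidec_ex:
  assumes "tdec (Suc n) (\<lambda>ys. Q (hd ys) (tl ys))"
  shows "semidec n (\<lambda>xs. \<exists>z. Q z xs)"
proof -
  have mu: "partrec n (\<lambda>xs. if \<exists>z. Some (if \<not> Q z xs then 1 else 0) = Some (0::nat) \<and>
        (\<forall>y<z. Some (if \<not> Q y xs then 1 else 0) \<noteq> (None :: nat option))
      then Some (LEAST z. Some (if \<not> Q z xs then 1 else 0) = Some (0::nat)) else None)"
    using partrec.mu[OF tdec_Not[OF assms, unfolded tdec_def trec_def]]
    by (simp only: list.sel)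
  show ?thesis unfolding semidec_def by (rule exI, rule conjI, rule mu) auto
qed

lemma semidec_tdec: "tdec n Q \<Longrightarrow> semidec n Q"
  using semidec_ex[of n "\<lambda>z. Q"] trec_tl by (auto simp: tdec_def)

lemma ce_rel_iff_semidec: "ce_rel R \<longleftrightarrow> semidec 2 (\<lambda>xs. R (xs ! 0) (xs ! 1))"
proof -
  have "(\<forall>i x. R i x \<longleftrightarrow> \<psi> [i, x] \<noteq> None) \<longleftrightarrow>
      (\<forall>xs. length xs = 2 \<longrightarrow> (R (xs ! 0) (xs ! 1) \<longleftrightarrow> \<psi> xs \<noteq> None))" for \<psi> :: "nat list \<Rightarrow> nat option"
    by (force simp: numeral_2_eq_2 length_Suc_conv)
  then show ?thesis by (simp add: ce_rel_def semidec_def)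
qed

lemma semidec_ce_rel:
  assumes "ce_rel R" "trec n f" "trec n g"
  shows "semidec n (\<lambda>xs. R (f xs) (g xs))"
  using semidec_subst[of "[f, g]" "\<lambda>xs. R (xs ! 0) (xs ! 1)" n] assms
  by (auto simp: ce_rel_iff_semidec numeral_2_eq_2)

section \<open>Machines on constant texts\<close>

text \<open>Values before the guess only have to be defined, not \<open>?\<close>; this makes the
  set the domain of an unbounded search.\<close>

definition const_success :: "(nat list \<Rightarrow> hypothesis option) \<Rightarrow> nat set" where
  "const_success M = {x. \<exists>k. (\<exists>c. M (replicate k x) = Some (Hyp c)) \<and>
    (\<forall>k'<k. M (replicate k' x) \<noteq> None)}"

text \<open>Block m refers to machines only through \<open>W m\<close>: an index of this c.e. set
  plays the role of an index of \<open>M\<close>.\<close>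

lemma ce_set_const_success:
  assumes "learning_machine M"
  shows "ce_set (const_success M)"
proof -
  let ?\<phi> = "\<lambda>ys. map_option hyp_encode (M (replicate (ys ! 0) (ys ! 1)))"
  have "partrec 2 ?\<phi>"
    using partrec_subst[of "[\<lambda>ys. list_encode (replicate (ys ! 0) (ys ! 1))]" _ 2]
      assms[unfolded learning_machine_def]
    by (force intro: trec_replicate trec_vars)
  \<comment> \<open>\<open>1 - v\<close> sends codes of guesses to 0 and the code of
    \<open>?\<close> to 1, so \<open>mu\<close> finds the first guess.\<close>
  then have "partrec 2 (\<lambda>ys. Option.bind (those (map (\<lambda>h. h ys) [?\<phi>])) (\<lambda>vs. Some (1 - vs ! 0)))"
    by (intro partrec.comp)
      (use trec_diff[OF trec_const trec_nth, of 0 1 1] in \<open>auto simp: trec_def\<close>)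
  then have "partrec 2 (\<lambda>ys. map_option (\<lambda>v. 1 - v) (?\<phi> ys))"
    by (rule partrec.ext) (auto split: option.splits)
  then have mu: "partrec 1 (\<lambda>xs.
      if \<exists>z. map_option (\<lambda>v. 1 - v) (?\<phi> (z # xs)) = Some 0 \<and>
        (\<forall>y<z. map_option (\<lambda>v. 1 - v) (?\<phi> (y # xs)) \<noteq> None)
      then Some (LEAST z. map_option (\<lambda>v. 1 - v) (?\<phi> (z # xs)) = Some 0) else None)"
    by (intro partrec.mu) (simp add: numeral_2_eq_2)
  have hyp: "map_option (\<lambda>v. 1 - v) (map_option hyp_encode v) = Some 0 \<longleftrightarrow> (\<exists>c. v = Some (Hyp c))"
    for v
  proof (cases v)
    case (Some w)
    then show ?thesis by (cases w) auto
  qed simp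
  show ?thesis
    unfolding ce_set_def
    by (rule exI, rule conjI, rule mu, unfold hyp const_success_def) auto
qed

lemma init_seg_eq_replicate:
  assumes "\<And>i. i < n \<Longrightarrow> f i = x"
  shows "init_seg f n = replicate n x"
  using assms by (intro nth_equalityI) (auto simp: init_seg_def)

text \<open>The constant text enumerates the singleton, so a guess must be made on it.\<close>

lemma const_success_if_learns_singleton:
  assumes "txtfin_learns W M {x}"
  shows "x \<in> const_success M"
proof -
  have "txtfin_identifies W M (\<lambda>_. x)"
    using assms by (auto simp: txtfin_learns_def content_def)
  then obtain n c where "\<forall>n'<n. M (replicate n' x) = Some NoHyp" "M (replicate n x) = Some (Hyp c)"
    by (auto simp: txtfin_identifies_def init_seg_eq_replicate)
  then show ?thesis by (auto simp: const_success_def)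
qed

text \<open>The least k at which M leaves ``?'' on a constant text already fixes the final guess on
  every text that starts with k copies of x.\<close>

lemma const_success_learns_unique:
  assumes "x \<in> const_success M" "txtfin_learns W M A" "txtfin_learns W M B" "x \<in> A" "x \<in> B"
  shows "A = B"
proof -
  obtain k c where k: "M (replicate k x) = Some (Hyp c)"
    using assms(1) by (auto simp: const_success_def)
  have *: "\<exists>n c. (\<forall>n'<n. M (replicate n' x) = Some NoHyp) \<and> M (replicate n x) = Some (Hyp c) \<and> W c = S"
    if "txtfin_learns W M S" "x \<in> S" for S
  proof -
    \<comment> \<open>A text of \<open>S\<close> starting with k copies of x; x also fills the later
      positions that correspond to no element of \<open>S\<close>.\<close>
    define f where "f i = (if i < k then x else if i - k \<in> S then i - k else x)" for i
    have "content f = S"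
    proof (intro equalityI subsetI)
      fix y assume "y \<in> S"
      then have "f (y + k) = y" by (simp add: f_def)
      then show "y \<in> content f" by (auto simp: content_def)
    qed (use that in \<open>auto simp: content_def f_def\<close>)
    then have "\<exists>n c. (\<forall>n'<n. M (init_seg f n') = Some NoHyp) \<and>
        M (init_seg f n) = Some (Hyp c) \<and> W c = S"
      using that(1) by (auto simp: txtfin_learns_def txtfin_identifies_def)
    then obtain n c' where n: "\<forall>n'<n. M (init_seg f n') = Some NoHyp"
      "M (init_seg f n) = Some (Hyp c')" "W c' = S"
      by blast
    have init: "init_seg f i = replicate i x" if "i \<le> k" for i
      using that by (intro init_seg_eq_replicate) (auto simp: f_def)
    have "n \<le> k"
    proof (rule ccontr)
      assume "\<not> n \<le> k"
      then show False using n(1)[rule_format, of k] k init[of k] by simp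
    qed
    then show ?thesis using n init by (intro exI[of _ n] exI[of _ c']) auto
  qed
  obtain n1 c1 where 1: "\<forall>n'<n1. M (replicate n' x) = Some NoHyp"
    "M (replicate n1 x) = Some (Hyp c1)" "W c1 = A"
    using *[OF assms(2,4)] by auto
  obtain n2 c2 where 2: "\<forall>n'<n2. M (replicate n' x) = Some NoHyp"
    "M (replicate n2 x) = Some (Hyp c2)" "W c2 = B"
    using *[OF assms(3,5)] by auto
  have "n1 = n2"
    by (rule linorder_cases[of n1 n2]) (use 1 2 in auto)
  then show ?thesis using 1 2 by simp
qed

section \<open>The family\<close>

text \<open>The candidate a may change with k, yet failure at some k persists for all larger
  ones.\<close>

definition survives :: "(nat \<Rightarrow> nat \<Rightarrow> nat \<Rightarrow> nat \<Rightarrow> bool) \<Rightarrow> nat \<Rightarrow> nat \<Rightarrow> nat \<Rightarrow> bool" where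
  "survives R e m k \<longleftrightarrow> (\<exists>a\<le>m. \<forall>b<k. \<exists>c. R e a b c)"

definition marker :: "nat \<Rightarrow> nat" where
  "marker m = prod_encode (m, prod_encode (0, 0))"

text \<open>In a code \<open>(m, j, d)\<close> of an element, m is the block, j the level (0 for the marker) and d the
  tag; \<open>survives R e m k\<close> says that level k is made common. As it holds for \<open>k = 0\<close>, the private
  elements of level 1 appear as soon as the machine guesses on the marker.\<close>

definition block_set :: "(nat \<Rightarrow> nat set) \<Rightarrow> (nat \<Rightarrow> nat \<Rightarrow> nat \<Rightarrow> nat \<Rightarrow> bool) \<Rightarrow>
    nat \<Rightarrow> nat \<Rightarrow> nat \<Rightarrow> nat set" where
  "block_set W R e m b = {prod_encode (m, prod_encode (j, d)) | j d.
    if j = 0 then d = 0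
    else marker m \<in> W m \<and> survives R e m (if d = b then j - 1 else j)}"

definition member :: "(nat \<Rightarrow> nat set) \<Rightarrow> (nat \<Rightarrow> nat \<Rightarrow> nat \<Rightarrow> nat \<Rightarrow> bool) \<Rightarrow>
    nat \<Rightarrow> nat \<Rightarrow> nat set" where
  "member W R e i = block_set W R e (fst (prod_decode i)) (snd (prod_decode i))"

lemma survives_0: "survives R e m 0"
  by (auto simp: survives_def)

text \<open>There are finitely many candidates: if each fails at some b, a level above the largest
  of these refutes all of them at once.\<close>

lemma survives_forever_iff:
  "(\<forall>k. survives R e m k) \<longleftrightarrow> (\<exists>a\<le>m. \<forall>b. \<exists>c. R e a b c)"
proof
  assume all: "\<forall>k. survives R e m k"
  show "\<exists>a\<le>m. \<forall>b. \<exists>c. R e a b c"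
  proof (rule ccontr)
    assume "\<not> ?thesis"
    then have "\<forall>a\<in>{..m}. \<exists>b. \<not> (\<exists>c. R e a b c)" by auto
    then obtain w where w: "\<forall>a\<in>{..m}. \<not> (\<exists>c. R e a (w a) c)" by metis
    obtain a where "a \<le> m" "\<forall>b<Suc (Max (w ` {..m})). \<exists>c. R e a b c"
      using all unfolding survives_def by blast
    moreover have "w a < Suc (Max (w ` {..m}))" using \<open>a \<le> m\<close> by (simp add: less_Suc_eq_le)
    ultimately show False using w by auto
  qed
qed (auto simp: survives_def)

section \<open>Uniform enumerability of the family and its codes\<close>

text \<open>A common bound u on finitely many witnesses c leaves one existential quantifier over a
  decidable matrix, the form for \<open>semidec_ex\<close>.\<close>

lemma survives_bounded:
  "survives R e m k \<longleftrightarrow> (\<exists>u. \<exists>a<Suc m. \<forall>b<k. \<exists>c<u. R e a b c)"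
proof -
  have "\<exists>u. \<forall>b<k. \<exists>c<u. R e a b c" if "\<forall>b<k. \<exists>c. R e a b c" for a
    using that
  proof (induction k)
    case (Suc k)
    then obtain u c where "\<forall>b<k. \<exists>c<u. R e a b c" "R e a k c" by auto
    then have "\<forall>b<Suc k. \<exists>c'<max u (Suc c). R e a b c'"
      by (metis less_Suc_eq less_max_iff_disj lessI)
    then show ?case by blast
  qed simp
  then show ?thesis unfolding survives_def less_Suc_eq_le by blast
qed

lemma semidec_survives:
  assumes "decidable4 R" "trec n e" "trec n m" "trec n k"
  shows "semidec n (\<lambda>xs. survives R (e xs) (m xs) (k xs))"
proof -
  have "semidec 3 (\<lambda>xs. \<exists>u. \<exists>a<Suc (xs ! 1). \<forall>b<xs ! 2. \<exists>c<u. R (xs ! 0) a b c)"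
    by (intro semidec_ex tdec_ex_less tdec_all_less tdec_comp4[OF assms(1)] trec_intros) auto
  then have "semidec 3 (\<lambda>xs. survives R (xs ! 0) (xs ! 1) (xs ! 2))"
    by (simp add: survives_bounded)
  then show ?thesis
    using semidec_subst[of "[e, m, k]" "\<lambda>xs. survives R (xs ! 0) (xs ! 1) (xs ! 2)" n] assms
    by (auto simp: eval_nat_numeral)
qed

lemma mem_block_set:
  "prod_encode (m', prod_encode (j, d)) \<in> block_set W R e m b \<longleftrightarrow>
    m' = m \<and> (if j = 0 then d = 0
      else marker m \<in> W m \<and> survives R e m (if d = b then j - 1 else j))"
  by (auto simp: block_set_def)

lemma marker_in_block_set: "marker m \<in> block_set W R e m b"
  by (simp add: marker_def mem_block_set)

lemma semidec_block_set:
  assumes W: "standard_numbering W" and R: "decidable4 R"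
    and t: "trec n e" "trec n m" "trec n b" "trec n x"
  shows "semidec n (\<lambda>xs. x xs \<in> block_set W R (e xs) (m xs) (b xs))"
proof -
  have ce: "ce_rel (\<lambda>i x. x \<in> W i)" using W by (simp add: standard_numbering_def)
  have "partrec 1 (\<lambda>xs. Some 0)" by (rule partrec.zero)
  then have "ce_set UNIV" by (auto simp: ce_set_def)
  then obtain u where u: "W u = UNIV"
    using range_standard_numbering[OF W] by (metis (no_types, lifting) imageE mem_Collect_eq)
  let ?m = "\<lambda>xs. fst (prod_decode (x xs))"
  let ?j = "\<lambda>xs. fst (prod_decode (snd (prod_decode (x xs))))"
  let ?d = "\<lambda>xs. snd (prod_decode (snd (prod_decode (x xs))))"
  \<comment> \<open>Replacing m by the index u of UNIV at level 0 turns a disjunction into a conjunction.\<close>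
  have "semidec n (\<lambda>xs. (?m xs = m xs \<and> (?j xs \<noteq> 0 \<or> ?d xs = 0)) \<and>
      marker (m xs) \<in> W (if ?j xs = 0 then u else m xs) \<and>
      survives R (e xs) (m xs) (if ?d xs = b xs then ?j xs - 1 else ?j xs))"
    unfolding marker_def
    by (intro semidec_conj semidec_tdec semidec_ce_rel[OF ce] semidec_survives[OF R] trec_intros t)
  \<comment> \<open>At level 0 both \<open>j - 1\<close> and \<open>j\<close> are 0, so the last
    conjunct holds by \<open>survives_0\<close>.\<close>
  moreover have "x xs \<in> block_set W R (e xs) (m xs) (b xs) \<longleftrightarrow>
      (?m xs = m xs \<and> (?j xs \<noteq> 0 \<or> ?d xs = 0)) \<and>
      marker (m xs) \<in> W (if ?j xs = 0 then u else m xs) \<and>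
      survives R (e xs) (m xs) (if ?d xs = b xs then ?j xs - 1 else ?j xs)" for xs
    using mem_block_set[of "?m xs" "?j xs" "?d xs"] by (auto simp: u survives_0)
  ultimately show ?thesis by simp
qed

text \<open>\<open>p\<close> is inverted by search, so lying in a column becomes a c.e. relation of
  e and y; the s-m-n property of \<open>W\<close> supplies \<open>h\<close>.\<close>

lemma ex_code:
  assumes W: "standard_numbering W" and p: "pairing_function p" and R: "decidable4 R"
  shows "\<exists>h. computable h \<and> (\<forall>e i. column W p (h e) i = member W R e i)"
proof -
  define q where "q y = (LEAST z. p (fst (prod_decode z)) (snd (prod_decode z)) = y)" for y
  have comp: "computable2 p" and bij: "bij (\<lambda>(i, x). p i x)"
    using p by (auto simp: pairing_function_def)
  have surj: "\<exists>z. p (fst (prod_decode z)) (snd (prod_decode z)) = y" for y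
  proof -
    obtain i x where "p i x = y" using bij by (metis bij_pointE case_prod_conv surj_pair)
    then show ?thesis by (intro exI[of _ "prod_encode (i, x)"]) simp
  qed
  have "q (p i x) = prod_encode (i, x)" for i x
  proof -
    have "p (fst (prod_decode (q (p i x)))) (snd (prod_decode (q (p i x)))) = p i x"
      unfolding q_def by (rule LeastI_ex[OF surj])
    then have "prod_decode (q (p i x)) = (i, x)"
      using bij_is_inj[OF bij, THEN injD, of "prod_decode (q (p i x))" "(i, x)"]
      by (simp add: case_prod_beta)
    then show ?thesis by (metis prod_decode_inverse)
  qed
  moreover have "trec 2 (\<lambda>xs. q (xs ! 1))"
    unfolding q_def by (rule trec_Least) (use surj in \<open>auto intro!: tdec_eq trec_comp2[OF comp] trec_intros\<close>)
  then have "ce_rel (\<lambda>e y. snd (prod_decode (q y)) \<in> member W R e (fst (prod_decode (q y))))"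
    unfolding ce_rel_iff_semidec member_def
    by (intro semidec_block_set[OF W R] trec_intros) auto
  then obtain h where "computable h"
    "\<And>e. W (h e) = {y. snd (prod_decode (q y)) \<in> member W R e (fst (prod_decode (q y)))}"
    using W by (auto simp: standard_numbering_def)
  ultimately show ?thesis by (intro exI[of _ h]) (auto simp: column_def)
qed

section \<open>Correctness of the reduction\<close>

lemma learnable_imp:
  assumes W: "standard_numbering W" and "txtfin_learnable W (range (member W R e))"
  shows "\<exists>a. \<forall>b. \<exists>c. R e a b c"
proof (rule ccontr)
  assume not: "\<not> ?thesis"
  obtain M where M: "learning_machine M" "\<And>i. txtfin_learns W M (member W R e i)"
    using assms(2) by (auto simp: txtfin_learnable_def)
  \<comment> \<open>For this \<open>m\<close>, block m is the one built against \<open>M\<close>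
    itself.\<close>
  obtain m where m: "W m = const_success M"
    using ce_set_const_success[OF M(1)] range_standard_numbering[OF W]
    by (metis (no_types, lifting) imageE mem_Collect_eq)
  have learn: "txtfin_learns W M (block_set W R e m b)" for b
    using M(2)[of "prod_encode (m, b)"] by (simp add: member_def)
  show False
  proof (cases "marker m \<in> W m")
    case False
    \<comment> \<open>Without a guess on the marker no positive level is present; learning the
      remaining singleton would force such a guess.\<close>
    then have "block_set W R e m 0 = {marker m}"
      by (auto simp: block_set_def marker_def split: if_splits)
    then show False
      using learn[of 0] False const_success_if_learns_singleton m by simp
  next
    case True
    have "\<exists>k. \<not> survives R e m k" using not survives_forever_iff by blast
    then have k: "\<not> survives R e m (LEAST k. \<not> survives R e m k)" by (rule LeastI_ex)
    then obtain k' where k': "(LEAST k. \<not> survives R e m k) = Suc k'"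
      by (metis not0_implies_Suc survives_0)
    then have "survives R e m k'" using not_less_Least[of k' "\<lambda>k. \<not> survives R e m k"] by simp
    \<comment> \<open>The element of level \<open>Suc k'\<close> tagged 0 enters set 0 because level
      \<open>k'\<close> survives, but would enter set 1 only if level \<open>Suc k'\<close>
      did.\<close>
    then have "prod_encode (m, prod_encode (Suc k', 0)) \<in> block_set W R e m 0"
      "prod_encode (m, prod_encode (Suc k', 0)) \<notin> block_set W R e m 1"
      using k k' True by (auto simp: mem_block_set)
    moreover have "block_set W R e m 0 = block_set W R e m 1"
      by (rule const_success_learns_unique[OF _ learn learn])
        (use True m marker_in_block_set in auto)
    ultimately show False by simp
  qed
qed

lemma last_init_seg: "last (init_seg f (Suc n)) = f n"
  by (simp add: init_seg_def)

lemma learnable_if: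
  assumes W: "standard_numbering W" and R: "decidable4 R" and a: "\<forall>b. \<exists>c. R e a b c"
  shows "txtfin_learnable W (range (member W R e))"
proof -
  \<comment> \<open>The level of the private elements that are never made common, or 0 if all sets in the block
    are equal. It is not computable in general, but here has finite support.\<close>
  define T where "T m = (if marker m \<in> W m \<and> (\<exists>k. \<not> survives R e m k)
    then LEAST k. \<not> survives R e m k else 0)" for m
  \<comment> \<open>From a on, the true witness a is among the candidates, so no level
    fails.\<close>
  have T_support: "T m = 0" if "m \<ge> a" for m
    using that a survives_forever_iff[of R e m] by (auto simp: T_def)
  have T0: "block_set W R e m b = block_set W R e m d" if "T m = 0" for m b d
  proof -
    \<comment> \<open>The value 0 is never a least failing level, since level 0 always
      survives.\<close>
    have "marker m \<notin> W m \<or> (\<forall>k. survives R e m k)"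
    proof (rule ccontr)
      assume *: "\<not> ?thesis"
      then have "\<not> survives R e m (T m)"
        using LeastI_ex[of "\<lambda>k. \<not> survives R e m k"] by (auto simp: T_def)
      then show False using that survives_0 by metis
    qed
    then have "prod_encode (m', prod_encode (j, d')) \<in> block_set W R e m b \<longleftrightarrow>
        prod_encode (m', prod_encode (j, d')) \<in> block_set W R e m d" for m' j d'
      by (auto simp: mem_block_set)
    then show ?thesis by (metis prod_decode_inverse surj_pair subsetI subset_antisym)
  qed
  \<comment> \<open>Level \<open>T m\<close> fails but the level before it survives, so there set b
    contains exactly the element with its own tag.\<close>
  have TJ: "prod_encode (m, prod_encode (T m, d)) \<in> block_set W R e m b \<longleftrightarrow> d = b"
    if "T m \<noteq> 0" for m b d
  proof -
    have *: "marker m \<in> W m" "\<exists>k. \<not> survives R e m k" using that by (auto simp: T_def split: if_splits)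
    then have T: "T m = (LEAST k. \<not> survives R e m k)" by (simp add: T_def)
    have "\<not> survives R e m (T m)" unfolding T by (rule LeastI_ex[OF *(2)])
    moreover have "survives R e m (T m - 1)"
      using not_less_Least[of "T m - 1" "\<lambda>k. \<not> survives R e m k"] that T by simp
    ultimately show ?thesis using that * by (auto simp: mem_block_set)
  qed
  have "ce_rel (\<lambda>i x. x \<in> member W R e i)"
    unfolding ce_rel_iff_semidec member_def
    by (intro semidec_block_set[OF W R] trec_intros) auto
  then obtain s where s: "computable s" "\<And>i. W (s i) = member W R e i"
    using W by (auto simp: standard_numbering_def)
  \<comment> \<open>The tag d names a correct set if all sets of the block agree, or if x is on
    level \<open>T m\<close>, where elements stay private.\<close>
  define g where "g x = (let m = fst (prod_decode x); j = fst (prod_decode (snd (prod_decode x)));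
      d = snd (prod_decode (snd (prod_decode x)))
    in if T m = 0 \<or> T m = j then Hyp (s (prod_encode (m, d))) else NoHyp)" for x
  define M where "M \<sigma> = Some (if \<sigma> = [] then NoHyp else g (last \<sigma>))" for \<sigma>
  \<comment> \<open>The machine on codes: 0 codes the empty string as input and \<open>?\<close> as
    output; a successor output is a guess.\<close>
  have "trec 1 (\<lambda>xs. if xs ! 0 = 0 then 0
      else if T (fst (prod_decode (last (list_decode (xs ! 0))))) = 0 \<or>
        T (fst (prod_decode (last (list_decode (xs ! 0))))) =
          fst (prod_decode (snd (prod_decode (last (list_decode (xs ! 0))))))
      then Suc (s (prod_encode (fst (prod_decode (last (list_decode (xs ! 0)))),
        snd (prod_decode (snd (prod_decode (last (list_decode (xs ! 0)))))))))
      else 0)"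
    by (intro trec_intros trec_last trec_finite_support[OF T_support] trec_comp1[OF s(1)]) auto
  moreover have "list_decode z = [] \<longleftrightarrow> z = 0" for z
    by (metis list_decode.simps(1) list_decode_inverse list_encode.simps(1))
  ultimately have "learning_machine M"
    unfolding learning_machine_def M_def g_def Let_def trec_def
    by (elim partrec.ext) auto
  moreover have "txtfin_learns W M (block_set W R e m b)" for m b
    unfolding txtfin_learns_def
  proof (intro allI impI)
    fix f assume f: "content f = block_set W R e m b"
    have in_block: "f n \<in> block_set W R e m b" for n using f by (auto simp: content_def)
    \<comment> \<open>Either any element of the block triggers a guess, or the private element of
      level \<open>T m\<close> occurs in the text.\<close>
    have "\<exists>n. g (f n) \<noteq> NoHyp"
    proof (cases "T m = 0")
      case True
      then have "g (f 0) \<noteq> NoHyp"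
        using in_block[of 0] by (auto simp: block_set_def g_def)
      then show ?thesis ..
    next
      case False
      then have "prod_encode (m, prod_encode (T m, b)) \<in> content f" using TJ f by simp
      then obtain n where "f n = prod_encode (m, prod_encode (T m, b))" by (auto simp: content_def)
      then have "g (f n) \<noteq> NoHyp" by (simp add: g_def)
      then show ?thesis ..
    qed
    then obtain n where n: "g (f n) \<noteq> NoHyp" "\<And>i. i < n \<Longrightarrow> g (f i) = NoHyp"
      using exists_least_iff[of "\<lambda>n. g (f n) \<noteq> NoHyp"] by auto
    obtain j d where jd: "f n = prod_encode (m, prod_encode (j, d))"
      using in_block[of n] by (auto simp: block_set_def)
    \<comment> \<open>The entry \<open>f n\<close> is first seen as the last one of the string of
      length \<open>Suc n\<close>, hence the shift.\<close>
    have "M (init_seg f i) = Some NoHyp" if "i < Suc n" for i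
    proof (cases i)
      case 0
      then show ?thesis by (simp add: M_def init_seg_def)
    next
      case (Suc i')
      then show ?thesis using n(2)[of i'] that last_init_seg[of f i'] by (simp add: M_def)
    qed
    moreover have g: "g (f n) = Hyp (s (prod_encode (m, d)))" and T: "T m = 0 \<or> T m = j"
      using n(1) by (auto simp: g_def jd split: if_splits)
    then have "M (init_seg f (Suc n)) = Some (Hyp (s (prod_encode (m, d))))"
      using last_init_seg[of f n] by (simp add: M_def init_seg_def)
    \<comment> \<open>If \<open>T m = 0\<close>, the tag d may differ from b, but all sets of the
      block coincide; otherwise level \<open>T m\<close> forces d = b.\<close>
    moreover have "block_set W R e m d = block_set W R e m b"
    proof (cases "T m = 0")
      case True
      then show ?thesis by (rule T0)
    next
      case False
      then show ?thesis using T TJ[of m d b] in_block[of n] jd by simp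
    qed
    then have "W (s (prod_encode (m, d))) = content f" by (simp add: s(2) member_def f)
    ultimately show "txtfin_identifies W M f"
      unfolding txtfin_identifies_def by blast
  qed
  ultimately show ?thesis by (auto simp: txtfin_learnable_def member_def)
qed

theorem theorem2p2:
  fixes W :: "nat \<Rightarrow> nat set" and p :: "nat \<Rightarrow> nat \<Rightarrow> nat"
  assumes "standard_numbering W"
    and "pairing_function p"
  shows "Sigma3_hard (FINL W p)"
  unfolding Sigma3_hard_def
proof (intro allI impI)
  fix P assume "Sigma3 P"
  then obtain R where R: "decidable4 R" "\<And>e. P e \<longleftrightarrow> (\<exists>a. \<forall>b. \<exists>c. R e a b c)"
    by (auto simp: Sigma3_def)
  obtain h where h: "computable h" "\<And>e i. column W p (h e) i = member W R e i"
    using ex_code[OF assms R(1)] by blast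
  have "P e \<longleftrightarrow> h e \<in> FINL W p" for e
    using learnable_imp[OF assms(1), of R e] learnable_if[OF assms(1) R(1), of e]
    by (auto simp: FINL_def uce_family_def h(2)[abs_def] R(2))
  then show "\<exists>h. computable h \<and> (\<forall>e. P e \<longleftrightarrow> h e \<in> FINL W p)"
    using h(1) by blast
qed

end
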